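(* If $\mu$ and $\nu$ are probability measures on the real line, then the function $$F(z)=F_\mu(F_\nu(z))-F_\nu(z)+z,$$ defined on $\mathbb{C}^+$, is the reciprocal Cauchy transform of a probability measure on the real line.
   Context: $\mathbb{C}^+$ is the open upper half-plane. The Cauchy transform of a Borel probability measure $\mu$ on $\mathbb{R}$ is $G_\mu(z)=\int_{\mathbb{R}}\frac{\mu(dx)}{z-x}$, $z\in\mathbb{C}^+$, and its reciprocal Cauchy transform is $F_\mu(z)=1/G_\mu(z)$ (a holomorphic map of $\mathbb{C}^+$ into itself). *)

theory Defs
  imports "HOL-Probability.Probability"
begin

definition upper_half_plane :: "complex set" where
  "upper_half_plane = {z. Im z > 0}"

(* Both transforms are total functions on the complex numbers; only their values on
   the upper half-plane are meaningful.  For a probability measure the integrand is bounded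
   there, so the Bochner integral is the genuine one, and its value is nonzero. *)

definition cauchy_transform :: "real measure \<Rightarrow> complex \<Rightarrow> complex" where
  "cauchy_transform M z = (\<integral>x. 1 / (z - complex_of_real x) \<partial>M)"

definition recip_cauchy_transform :: "real measure \<Rightarrow> complex \<Rightarrow> complex" where
  "recip_cauchy_transform M z = 1 / cauchy_transform M z"

end

theory Submission
  imports Defs "HOL-Complex_Analysis.Complex_Analysis"
begin

text \<open>Write \<open>F\<^sub>\<mu>\<close> and \<open>F\<^sub>\<nu>\<close> for the reciprocal Cauchy transforms and \<open>F z = F\<^sub>\<mu> (F\<^sub>\<nu> z) - F\<^sub>\<nu> z + z\<close>. The proof
recognises reciprocal Cauchy transforms among all holomorphic functions on the upper half-plane by
two analytic properties: they satisfy \<open>Im (F z) \<ge> Im z\<close>, and \<open>F (\<i> y) / (\<i> y)\<close> tends to 1 as \<open>y\<close> tends to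
infinity. Both properties pass to the combination \<open>F\<close>.

For the first, \<open>Im (F\<^sub>\<mu> w) \<ge> Im w\<close> holds at \<open>w = F\<^sub>\<nu> z\<close>, and adding \<open>Im z\<close> gives the claim. The inequality itself
is Jensen's inequality (lemma \<open>Im_recip_cauchy_transform_ge\<close>). For the second, the points
\<open>F\<^sub>\<nu> (\<i> y)\<close> tend to infinity nontangentially, and \<open>F\<^sub>\<mu> w / w\<close> tends to 1 along every nontangential sequence
(lemma \<open>recip_cauchy_transform_nontangential_limit\<close>).

That the two properties are sufficient is lemma \<open>cauchy_transform_representation\<close>, applied to
\<open>G = 1 / F\<close>. They imply that \<open>Im G \<le> 0\<close>, that \<open>cmod (G z) \<le> 1 / Im z\<close> and that \<open>y * Im (G (\<i> y))\<close> tends to -1. If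
\<open>G\<close> is holomorphic across the real line, the measure is found by Stieltjes inversion, with
density \<open>- Im G / \<pi>\<close>, from the Poisson integral formula (lemma \<open>cauchy_representation_smooth\<close>). The
general case follows by shifting \<open>G\<close> slightly upwards and passing to a weak limit, where
the limit of \<open>y * Im (G (\<i> y))\<close> prevents mass from escaping to infinity.\<close>

section \<open>Cauchy transforms of probability measures\<close>

lemma open_upper_half_plane: "open upper_half_plane"
  unfolding upper_half_plane_def by (rule open_halfspace_Im_gt)

lemma convex_upper_half_plane: "convex upper_half_plane"
  unfolding upper_half_plane_def by (rule convex_halfspace_Im_gt)

lemma Im_le_cmod_diff_of_real: "Im z \<le> cmod (z - complex_of_real x)"
  using abs_Im_le_cmod[of "z - complex_of_real x"] by simp

lemma cauchy_kernel_bound: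
  assumes "Im z > 0"
  shows "cmod (1 / (z - complex_of_real x)) \<le> 1 / Im z"
  using assms Im_le_cmod_diff_of_real[of z x] by (simp add: norm_divide frac_le)

lemma diff_of_real_nonzero: "Im z > 0 \<Longrightarrow> z - complex_of_real x \<noteq> 0"
  by (auto simp: complex_eq_iff)

lemma Im_cauchy_kernel:
  "Im (1 / (z - complex_of_real x)) = - (Im z * (cmod (1 / (z - complex_of_real x)))\<^sup>2)"
  by (simp add: Im_divide cmod_power2 norm_divide power_divide)

context real_distribution
begin

lemma cauchy_kernel_integrable:
  assumes "Im z > 0"
  shows "integrable M (\<lambda>x. 1 / (z - complex_of_real x))"
  using cauchy_kernel_bound[OF assms]
  by (intro integrable_const_bound[where B = "1 / Im z"]) auto

lemma cauchy_kernel_square_integrable: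
  assumes "Im z > 0"
  shows "integrable M (\<lambda>x. (cmod (1 / (z - complex_of_real x)))\<^sup>2)"
proof (rule integrable_const_bound[where B = "(1 / Im z)\<^sup>2"])
  show "AE x in M. norm ((cmod (1 / (z - complex_of_real x)))\<^sup>2) \<le> (1 / Im z)\<^sup>2"
    using power_mono[OF cauchy_kernel_bound[OF assms] norm_ge_zero, of _ 2]
    by (auto simp del: norm_divide)
qed auto

lemma cauchy_transform_bound:
  assumes "Im z > 0"
  shows "cmod (cauchy_transform M z) \<le> 1 / Im z"
proof -
  have "cmod (cauchy_transform M z) \<le> expectation (\<lambda>x. cmod (1 / (z - complex_of_real x)))"
    unfolding cauchy_transform_def by (rule integral_norm_bound)
  also have "\<dots> \<le> 1 / Im z"
    using cauchy_kernel_integrable[OF assms] cauchy_kernel_bound[OF assms]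
    by (intro integral_le_const) auto
  finally show ?thesis .
qed

lemma Im_cauchy_transform:
  assumes "Im z > 0"
  shows "Im (cauchy_transform M z) =
    - (Im z * expectation (\<lambda>x. (cmod (1 / (z - complex_of_real x)))\<^sup>2))"
proof -
  have "Im (cauchy_transform M z) = expectation (\<lambda>x. Im (1 / (z - complex_of_real x)))"
    unfolding cauchy_transform_def
    by (rule integral_Im[OF cauchy_kernel_integrable[OF assms], symmetric])
  then show ?thesis by (simp only: Im_cauchy_kernel) simp
qed

text \<open>Jensen's inequality: the squared modulus of the mean of the kernel is at most the mean of its
squared modulus, and the latter is, up to the factor \<^term>\<open>- Im z\<close>, the imaginary part of the
transform.\<close>

lemma cmod_cauchy_transform_square_le:
  assumes "Im z > 0"
  shows "Im z * (cmod (cauchy_transform M z))\<^sup>2 \<le> - Im (cauchy_transform M z)"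
proof -
  let ?X = "\<lambda>x. cmod (1 / (z - complex_of_real x))"
  have "cmod (cauchy_transform M z) \<le> expectation ?X"
    unfolding cauchy_transform_def by (rule integral_norm_bound)
  then have "(cmod (cauchy_transform M z))\<^sup>2 \<le> (expectation ?X)\<^sup>2"
    by (intro power_mono) auto
  also have "\<dots> \<le> expectation (\<lambda>x. (?X x)\<^sup>2)"
    using variance_eq[OF integrable_norm[OF cauchy_kernel_integrable[OF assms]]
        cauchy_kernel_square_integrable[OF assms]]
      variance_positive[of ?X] by linarith
  finally show ?thesis
    using assms by (simp only: Im_cauchy_transform[OF assms] minus_minus) simp
qed

lemma Im_cauchy_transform_neg:
  assumes "Im z > 0"
  shows "Im (cauchy_transform M z) < 0"
proof -
  have "expectation (\<lambda>x. (cmod (1 / (z - complex_of_real x)))\<^sup>2) > 0"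
    using diff_of_real_nonzero[OF assms]
    by (intro expectation_greater cauchy_kernel_square_integrable[OF assms]) auto
  then show ?thesis using assms by (simp only: Im_cauchy_transform[OF assms]) simp
qed

lemma Im_recip_cauchy_transform_ge:
  assumes "Im z > 0"
  shows "Im (recip_cauchy_transform M z) \<ge> Im z"
proof -
  have nz: "cauchy_transform M z \<noteq> 0" using Im_cauchy_transform_neg[OF assms] by auto
  have "Im (recip_cauchy_transform M z)
      = - Im (cauchy_transform M z) / (cmod (cauchy_transform M z))\<^sup>2"
    by (simp add: recip_cauchy_transform_def Im_divide cmod_power2)
  then show ?thesis
    using cmod_cauchy_transform_square_le[OF assms] nz
    by (simp only: pos_le_divide_eq zero_less_power2 norm_eq_zero simp_thms)
qed

text \<open>The resolvent identity, integrated. It gives the difference quotient of the transform in a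
form to which dominated convergence applies.\<close>

lemma cauchy_transform_diff:
  assumes "Im z > 0" "Im w > 0"
  shows "cauchy_transform M w - cauchy_transform M z
    = (z - w) * expectation (\<lambda>x. 1 / (w - complex_of_real x) * (1 / (z - complex_of_real x)))"
proof -
  have "cauchy_transform M w - cauchy_transform M z
    = expectation (\<lambda>x. 1 / (w - complex_of_real x) - 1 / (z - complex_of_real x))"
    unfolding cauchy_transform_def using assms by (simp add: cauchy_kernel_integrable)
  also have "\<dots> = expectation (\<lambda>x. (z - w) * (1 / (w - complex_of_real x) * (1 / (z - complex_of_real x))))"
    using diff_of_real_nonzero[OF assms(1)] diff_of_real_nonzero[OF assms(2)]
    by (intro Bochner_Integration.integral_cong) (auto simp: divide_simps)
  also have "\<dots> = (z - w) * expectation (\<lambda>x. 1 / (w - complex_of_real x) * (1 / (z - complex_of_real x)))"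
    by (rule integral_mult_right_zero)
  finally show ?thesis .
qed

lemma cauchy_transform_holomorphic: "cauchy_transform M holomorphic_on upper_half_plane"
proof -
  have "(cauchy_transform M has_field_derivative
      - expectation (\<lambda>x. 1 / (z - complex_of_real x) * (1 / (z - complex_of_real x)))) (at z)"
    if z: "Im z > 0" for z
    unfolding has_field_derivative_iff
  proof (rule Lim_transform_eventually)
    let ?E = "\<lambda>w. expectation (\<lambda>x. 1 / (w - complex_of_real x) * (1 / (z - complex_of_real x)))"
    \<comment> \<open>Points whose imaginary part is more than half that of \<^term>\<open>z\<close> keep the kernel bounded, which gives
      the dominating constant.\<close>
    have ev: "eventually (\<lambda>w. Im w > Im z / 2) (at z)"
      using z by (intro order_tendstoD(1)[OF tendsto_Im[OF tendsto_ident_at]]) auto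
    show "\<forall>\<^sub>F w in at z. - ?E w = (cauchy_transform M w - cauchy_transform M z) / (w - z)"
      using ev eventually_neq_at_within[of z]
    proof eventually_elim
      case (elim w)
      then show ?case using z cauchy_transform_diff[of z w] by (simp add: divide_simps algebra_simps)
    qed
    show "((\<lambda>w. - ?E w) \<longlongrightarrow> - ?E z) (at z)"
    proof (intro tendsto_minus, unfold tendsto_at_iff_sequentially, intro allI impI)
      fix X assume X: "\<forall>i. X i \<in> UNIV - {z}" "X \<longlonglongrightarrow> z"
      have evX: "eventually (\<lambda>n. Im (X n) > Im z / 2) sequentially"
        using tendsto_Im[OF X(2)] z by (intro order_tendstoD(1)) auto
      then obtain N where N: "\<And>n. n \<ge> N \<Longrightarrow> Im (X n) > Im z / 2"
        by (auto simp: eventually_sequentially)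
      have "(\<lambda>n. ?E (X (n + N))) \<longlonglongrightarrow> ?E z"
      proof (rule integral_dominated_convergence[where w = "\<lambda>_. (1 / (Im z / 2)) * (1 / Im z)"])
        show "AE x in M. (\<lambda>n. 1 / (X (n + N) - complex_of_real x) * (1 / (z - complex_of_real x)))
            \<longlonglongrightarrow> 1 / (z - complex_of_real x) * (1 / (z - complex_of_real x))"
          using diff_of_real_nonzero[OF z] X(2)
          by (intro AE_I2 tendsto_intros LIMSEQ_ignore_initial_segment) auto
        show "AE x in M. norm (1 / (X (n + N) - complex_of_real x) * (1 / (z - complex_of_real x)))
            \<le> 1 / (Im z / 2) * (1 / Im z)" for n
        proof (intro AE_I2)
          fix x
          have n: "Im (X (n + N)) > Im z / 2" using N by simp
          have "cmod (1 / (X (n + N) - complex_of_real x)) \<le> 1 / Im (X (n + N))"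
            using n z by (intro cauchy_kernel_bound) auto
          also have "\<dots> \<le> 1 / (Im z / 2)" using n z by (intro divide_left_mono) auto
          finally show "norm (1 / (X (n + N) - complex_of_real x) * (1 / (z - complex_of_real x)))
            \<le> 1 / (Im z / 2) * (1 / Im z)"
            unfolding norm_mult using z by (intro mult_mono cauchy_kernel_bound) auto
        qed
      qed auto
      then show "(?E \<circ> X) \<longlonglongrightarrow> ?E z"
        unfolding comp_def by (rule LIMSEQ_offset)
    qed
  qed
  then show ?thesis
    unfolding holomorphic_on_open[OF open_upper_half_plane]
    by (auto simp: upper_half_plane_def simp del: times_divide_times_eq)
qed

text \<open>The hypothesis \<open>cmod (z n) \<le> C * Im (z n)\<close> keeps the sequence in a Stolz angle at infinity.
There \<open>z / (z - x)\<close> is bounded by \<open>C\<close>, uniformly in \<open>x\<close>, and it tends to 1 for each \<open>x\<close>.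
A whole angle is needed, not only the imaginary axis, because the outer
transform is later evaluated along the image of the axis under the inner one.\<close>

lemma cauchy_transform_nontangential_limit:
  assumes z: "\<And>n. Im (z n) > 0" and nt: "eventually (\<lambda>n. cmod (z n) \<le> C * Im (z n)) sequentially"
    and inf: "filterlim (\<lambda>n. cmod (z n)) at_top sequentially"
  shows "(\<lambda>n. z n * cauchy_transform M (z n)) \<longlonglongrightarrow> 1"
proof -
  obtain N where N: "\<And>n. n \<ge> N \<Longrightarrow> cmod (z n) \<le> C * Im (z n)"
    using nt by (auto simp: eventually_sequentially)
  have "(\<lambda>n. expectation (\<lambda>x. z (n + N) * (1 / (z (n + N) - complex_of_real x))))
      \<longlonglongrightarrow> expectation (\<lambda>x. 1 :: complex)"
  proof (rule integral_dominated_convergence[where w = "\<lambda>_. C"])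
    show "AE x in M. (\<lambda>n. z (n + N) * (1 / (z (n + N) - complex_of_real x))) \<longlonglongrightarrow> 1"
    proof (intro AE_I2)
      fix x
      have "(\<lambda>n. inverse (z n)) \<longlonglongrightarrow> 0"
        using inf by (intro tendsto_inverse_0[THEN filterlim_compose] filterlim_norm_at_top_imp_at_infinity)
      then have "(\<lambda>n. 1 / (1 - complex_of_real x * inverse (z n))) \<longlonglongrightarrow> 1 / (1 - complex_of_real x * 0)"
        by (intro tendsto_intros) auto
      moreover have "1 / (1 - complex_of_real x * inverse (z n)) = z n * (1 / (z n - complex_of_real x))" for n
      proof -
        have "z n \<noteq> 0" using z[of n] by auto
        then show ?thesis using diff_of_real_nonzero[OF z[of n]] by (simp add: field_simps)
      qed
      ultimately show "(\<lambda>n. z (n + N) * (1 / (z (n + N) - complex_of_real x))) \<longlonglongrightarrow> 1"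
        by (intro LIMSEQ_ignore_initial_segment) simp
    qed
    show "AE x in M. norm (z (n + N) * (1 / (z (n + N) - complex_of_real x))) \<le> C" for n
    proof (intro AE_I2)
      fix x
      have "norm (z (n + N) * (1 / (z (n + N) - complex_of_real x))) \<le> cmod (z (n + N)) * (1 / Im (z (n + N)))"
        unfolding norm_mult by (intro mult_left_mono cauchy_kernel_bound z) auto
      also have "\<dots> \<le> C" using N[of "n + N"] z[of "n + N"] by (simp add: divide_le_eq)
      finally show "norm (z (n + N) * (1 / (z (n + N) - complex_of_real x))) \<le> C" .
    qed
  qed auto
  then have "(\<lambda>n. z (n + N) * cauchy_transform M (z (n + N))) \<longlonglongrightarrow> 1"
    using prob_space unfolding cauchy_transform_def by (simp del: mult_1_right times_divide_eq_right)
  then show ?thesis by (rule LIMSEQ_offset)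
qed

text \<open>A tail bound in terms of the transform at a single point: \<open>- y * Im\<close> of the transform at \<open>\<i> y\<close> is the mean
of \<open>y\<^sup>2 / (x\<^sup>2 + y\<^sup>2)\<close>, which is at most 1/2 as soon as \<open>\<bar>x\<bar> \<ge> y\<close>. Values of this mean close to 1,
uniformly over a family of measures, make the family tight.\<close>

lemma measure_interval_ge_cauchy_transform:
  assumes "y > 0"
  shows "prob {-y<..y} \<ge> - 2 * y * Im (cauchy_transform M (\<i> * of_real y)) - 1"
proof -
  have y: "Im (\<i> * complex_of_real y) > 0" using assms by simp
  have pt: "y\<^sup>2 * (cmod (1 / (\<i> * of_real y - complex_of_real x)))\<^sup>2
      \<le> 1/2 + 1/2 * indicator {-y<..y} x" for x
  proof -
    have eq: "(cmod (1 / (\<i> * of_real y - complex_of_real x)))\<^sup>2 = 1 / (x\<^sup>2 + y\<^sup>2)"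
      by (simp add: norm_divide power_divide cmod_power2)
    have p: "x\<^sup>2 + y\<^sup>2 > 0" using assms by (simp add: add_nonneg_pos)
    show ?thesis
    proof (cases "x \<in> {-y<..y}")
      case True
      then show ?thesis using p unfolding eq by simp
    next
      case False
      then have "\<bar>y\<bar> \<le> \<bar>x\<bar>" using assms by auto
      then have "y\<^sup>2 \<le> x\<^sup>2" by (simp add: abs_le_square_iff)
      then show ?thesis using p False unfolding eq by (simp add: divide_simps)
    qed
  qed
  have ind: "integrable M (\<lambda>x. 1/2 + 1/2 * indicator {-y<..y} x :: real)"
    by (intro integrable_const_bound[where B = 1]) (auto simp: indicator_def)
  have "- y * Im (cauchy_transform M (\<i> * of_real y))
      = expectation (\<lambda>x. y\<^sup>2 * (cmod (1 / (\<i> * of_real y - complex_of_real x)))\<^sup>2)"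
    by (simp only: Im_cauchy_transform[OF y]) (simp add: power2_eq_square)
  also have "\<dots> \<le> expectation (\<lambda>x. 1/2 + 1/2 * indicator {-y<..y} x)"
    using cauchy_kernel_square_integrable[OF y] pt
    by (intro integral_mono integrable_mult_right ind) (auto simp del: norm_divide)
  also have "\<dots> = 1/2 + 1/2 * prob {-y<..y}"
  proof -
    have "integrable M (\<lambda>x. 1/2 * indicator {-y<..y} x :: real)"
      by (intro integrable_const_bound[where B = 1]) (auto simp: indicator_def)
    then show ?thesis
      using prob_space by (subst Bochner_Integration.integral_add) auto
  qed
  finally show ?thesis by simp
qed

end

section \<open>The Poisson integral on the upper half-plane\<close>

text \<open>Cauchy's formula for \<open>w \<mapsto> g w / (w - cnj z)\<close>, which is holomorphic near the closed upper
half-plane, along the boundary of the rectangle with corners \<open>-R\<close> and \<open>R + \<i> R\<close>. Dividing by the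
reflected factor makes the integrand decay quadratically, so that the three far sides contribute
\<open>O(1/R)\<close> although \<open>g\<close> is merely bounded, and on the real line it turns the Cauchy kernel into the
Poisson kernel, which is positive.\<close>

lemma truncated_poisson_integral_tendsto:
  assumes d: "d > 0" and hol: "g holomorphic_on {z. Im z > - d}"
    and bd: "\<And>z. Im z \<ge> 0 \<Longrightarrow> cmod (g z) \<le> B" and z: "Im z > 0"
  shows "(\<lambda>n. integral {- real n..real n}
            (\<lambda>t. g (of_real t) / ((of_real t - cnj z) * (of_real t - z))))
          \<longlonglongrightarrow> of_real pi * g z / of_real (Im z)"
proof -
  define k where "k = (\<lambda>w. g w / ((w - cnj z) * (w - z)))"
  define S where "S = {w. Im w > - min d (Im z)}"
  define f where "f = (\<lambda>w. g w / (w - cnj z))"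
  have B: "B \<ge> 0" using bd[of 0] norm_ge_zero[of "g 0"] by (simp del: norm_ge_zero)
  have S: "open S" "convex S" "z \<in> S"
    using z d by (auto simp: S_def open_halfspace_Im_gt convex_halfspace_Im_gt)
  have fS: "f holomorphic_on S"
    unfolding f_def by (intro holomorphic_intros holomorphic_on_subset[OF hol]) (auto simp: S_def)
  have kS: "k holomorphic_on S - {z}"
    unfolding k_def by (intro holomorphic_intros holomorphic_on_subset[OF hol]) (auto simp: S_def)
  have fk: "f w / (w - z) = k w" for w by (simp add: f_def k_def)
  have fz: "2 * of_real pi * \<i> * f z = of_real pi * g z / of_real (Im z)"
  proof -
    have "z - cnj z = 2 * \<i> * of_real (Im z)" by (simp add: complex_eq_iff)
    then have "f z = g z / (2 * \<i> * of_real (Im z))" by (simp add: f_def)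
    then show ?thesis using z by (simp add: field_simps)
  qed
  \<comment> \<open>For these \<^term>\<open>R\<close> the far sides, of total length 4 R, are at distance at least R/2 from both
    \<^term>\<open>z\<close> and its conjugate.\<close>
  have key: "cmod (integral {- R..R} (\<lambda>t. k (of_real t)) - of_real pi * g z / of_real (Im z)) \<le> 16 * B / R"
    if R: "R > 2 * cmod z" for R
  proof -
    have R0: "R > 0" using R norm_ge_zero[of z] by linarith
    have zR: "\<bar>Re z\<bar> < R" "Im z < R"
      using R abs_Re_le_cmod[of z] abs_Im_le_cmod[of z] norm_ge_zero[of z] by linarith+
    define a1 a2 a3 a4 where "a1 = complex_of_real (- R)" and "a2 = complex_of_real R"
      and "a3 = Complex R R" and "a4 = Complex (- R) R"
    note adef = a1_def a2_def a3_def a4_def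
    have rp: "rectpath a1 a3 = linepath a1 a2 +++ linepath a2 a3 +++ linepath a3 a4 +++ linepath a4 a1"
      by (simp add: rectpath_def Let_def adef complex_of_real_def)
    have seg: "closed_segment a1 a2 \<subseteq> S - {z}" "closed_segment a2 a3 \<subseteq> S - {z}"
        "closed_segment a3 a4 \<subseteq> S - {z}" "closed_segment a4 a1 \<subseteq> S - {z}"
      using zR z d R0
      by (auto simp: adef S_def closed_segment_same_Re closed_segment_same_Im closed_segment_eq_real_ivl)
    have ci: "k contour_integrable_on linepath a1 a2" "k contour_integrable_on linepath a2 a3"
        "k contour_integrable_on linepath a3 a4" "k contour_integrable_on linepath a4 a1"
      using seg by (auto intro!: contour_integrable_continuous_linepath
          continuous_on_subset[OF holomorphic_on_imp_continuous_on[OF kS]])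
    have "((\<lambda>w. f w / (w - z)) has_contour_integral (2*pi * \<i> * winding_number (rectpath a1 a3) z * f z)) (rectpath a1 a3)"
    proof (rule Cauchy_integral_formula_convex_simple[OF S(2) fS])
      show "z \<in> interior S" using S by (simp add: interior_open)
      show "path_image (rectpath a1 a3) \<subseteq> S - {z}"
        using seg unfolding rp by (simp add: path_image_join)
    qed auto
    moreover have "winding_number (rectpath a1 a3) z = 1"
      using zR z by (intro winding_number_rectpath) (auto simp: in_box_complex_iff adef)
    ultimately have "contour_integral (rectpath a1 a3) k = of_real pi * g z / of_real (Im z)"
      by (simp add: fk fz contour_integral_unique)
    moreover have "contour_integral (rectpath a1 a3) k = contour_integral (linepath a1 a2) k
      + (contour_integral (linepath a2 a3) k + (contour_integral (linepath a3 a4) k + contour_integral (linepath a4 a1) k))"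
      unfolding rp using ci by simp
    moreover have "contour_integral (linepath a1 a2) k = integral {- R..R} (\<lambda>t. k (of_real t))"
      using R0 by (subst contour_integral_linepath_Reals_eq) (auto simp: adef)
    ultimately have eq: "integral {- R..R} (\<lambda>t. k (of_real t)) - of_real pi * g z / of_real (Im z)
       = - (contour_integral (linepath a2 a3) k + contour_integral (linepath a3 a4) k + contour_integral (linepath a4 a1) k)"
      by (simp add: algebra_simps)
    have kb: "cmod (k w) \<le> 4 * B / R\<^sup>2" if "Im w \<ge> 0" "cmod w \<ge> R" for w
    proof -
      have 1: "cmod (w - z) \<ge> R / 2" "cmod (w - cnj z) \<ge> R / 2"
        using norm_triangle_ineq2[of w z] norm_triangle_ineq2[of w "cnj z"] that R by auto
      have 2: "(R/2) * (R/2) \<le> cmod (w - cnj z) * cmod (w - z)"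
        using 1 R0 by (intro mult_mono) auto
      have "cmod (k w) \<le> B / ((R/2) * (R/2))"
        unfolding k_def norm_divide norm_mult using bd[OF that(1)] 2 R0 B by (intro frac_le) auto
      then show ?thesis by (simp add: power2_eq_square mult.commute)
    qed
    have side: "cmod (contour_integral (linepath a b) k) \<le> 4 * B / R\<^sup>2 * cmod (b - a)"
      if "k contour_integrable_on linepath a b" "\<And>w. w \<in> closed_segment a b \<Longrightarrow> Im w \<ge> 0 \<and> cmod w \<ge> R" for a b
      using that kb B by (intro contour_integral_bound_linepath) auto
    have far: "Im w \<ge> 0 \<and> cmod w \<ge> R"
      if "w \<in> closed_segment a2 a3 \<or> w \<in> closed_segment a3 a4 \<or> w \<in> closed_segment a4 a1" for w
    proof
      show "Im w \<ge> 0"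
        using that R0
        by (auto simp: adef closed_segment_same_Re closed_segment_same_Im closed_segment_eq_real_ivl)
      have "R \<le> \<bar>Re w\<bar> \<or> R \<le> \<bar>Im w\<bar>"
        using that R0
        by (auto simp: adef closed_segment_same_Re closed_segment_same_Im closed_segment_eq_real_ivl)
      then show "cmod w \<ge> R"
        using abs_Re_le_cmod[of w] abs_Im_le_cmod[of w] by linarith
    qed
    have len: "cmod (a3 - a2) = R" "cmod (a4 - a3) = 2 * R" "cmod (a1 - a4) = R"
      using R0 by (auto simp: adef cmod_def real_sqrt_mult)
    have "cmod (integral {- R..R} (\<lambda>t. k (of_real t)) - of_real pi * g z / of_real (Im z))
      \<le> 4 * B / R\<^sup>2 * R + 4 * B / R\<^sup>2 * (2 * R) + 4 * B / R\<^sup>2 * R"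
      unfolding eq norm_minus_cancel
      using side[OF ci(2)] side[OF ci(3)] side[OF ci(4)] far len
      by (intro norm_triangle_mono) auto
    also have "\<dots> = 16 * B / R" using R0 by (simp add: field_simps power2_eq_square)
    finally show ?thesis .
  qed
  have "(\<lambda>n. 16 * B / real n) \<longlonglongrightarrow> 0" by real_asymp
  moreover have "\<forall>\<^sub>F n in sequentially. norm (integral {- real n..real n} (\<lambda>t. k (of_real t))
      - of_real pi * g z / of_real (Im z)) \<le> 16 * B / real n"
    using filterlim_real_sequentially[unfolded filterlim_at_top_dense, rule_format, of "2 * cmod z"]
    by eventually_elim (rule key)
  ultimately have "(\<lambda>n. integral {- real n..real n} (\<lambda>t. k (of_real t))
      - of_real pi * g z / of_real (Im z)) \<longlonglongrightarrow> 0"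
    by (rule Lim_null_comparison[rotated])
  then show ?thesis unfolding k_def by (rule LIM_zero_cancel)
qed

text \<open>The sign of \<open>Im g\<close> on the real line makes the truncated integrals monotone, so their convergence
already yields integrability over the whole line.\<close>

lemma poisson_integral_formula:
  assumes d: "d > 0" and hol: "g holomorphic_on {z. Im z > - d}"
    and bd: "\<And>z. Im z \<ge> 0 \<Longrightarrow> cmod (g z) \<le> B"
    and neg: "\<And>z. Im z \<ge> 0 \<Longrightarrow> Im (g z) \<le> 0" and z: "Im z > 0"
  shows "has_bochner_integral lborel
     (\<lambda>t. - Im (g (of_real t)) * (cmod (1 / (z - of_real t)))\<^sup>2) (- (pi * Im (g z) / Im z))"
proof -
  define h where "h = (\<lambda>t. - Im (g (of_real t)) * (cmod (1 / (z - of_real t)))\<^sup>2)"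
  have cg: "continuous_on UNIV (\<lambda>t. g (complex_of_real t))"
    using d by (intro continuous_on_compose2[OF holomorphic_on_imp_continuous_on[OF hol]]
        continuous_intros) auto
  have ch: "continuous_on UNIV h"
    unfolding h_def using diff_of_real_nonzero[OF z] by (intro continuous_intros cg) auto
  define k where "k = (\<lambda>t. g (of_real t) / ((of_real t - cnj z) * (of_real t - z)))"
  have nz: "of_real t - cnj z \<noteq> 0" "of_real t - z \<noteq> 0" for t
    using z by (auto simp: complex_eq_iff)
  have ck: "continuous_on UNIV k"
    unfolding k_def using nz by (intro continuous_intros cg) auto
  have hk: "h t = - Im (k t)" for t
  proof -
    have "(of_real t - cnj z) * (of_real t - z) = of_real ((cmod (z - of_real t))\<^sup>2)"
      unfolding cmod_power2 by (simp add: complex_eq_iff power2_eq_square algebra_simps)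
    then show ?thesis by (simp add: h_def k_def norm_divide power_divide)
  qed
  have int_h: "integral {- real n..real n} h = - Im (integral {- real n..real n} k)" for n
  proof -
    have "integral {- real n..real n} (Im \<circ> k) = Im (integral {- real n..real n} k)"
      by (intro integral_linear bounded_linear_Im integrable_continuous_interval
          continuous_on_subset[OF ck]) auto
    moreover have "h = (\<lambda>t. - (Im \<circ> k) t)" using hk by auto
    ultimately show ?thesis by (simp add: comp_def)
  qed
  have set_h: "set_integrable lborel {- real n..real n} h" for n
    by (intro borel_integrable_atLeastAtMost' continuous_on_subset[OF ch]) auto
  have "has_bochner_integral lborel h (- (pi * Im (g z) / Im z))"
  proof (rule has_bochner_integral_monotone_convergence[where f = "\<lambda>n t. indicator {- real n..real n} t * h t"])
    show "integrable lborel (\<lambda>t. indicator {- real n..real n} t * h t)" for n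
      using set_h[of n] by (simp add: set_integrable_def)
    have h0: "h t \<ge> 0" for t unfolding h_def using neg[of "of_real t"] by (intro mult_nonneg_nonneg) auto
    show "AE t in lborel. mono (\<lambda>n. indicator {- real n..real n} t * h t)"
      using h0 by (intro AE_I2 monoI mult_right_mono) (auto simp: indicator_def)
    show "AE t in lborel. (\<lambda>n. indicator {- real n..real n} t * h t) \<longlonglongrightarrow> h t"
    proof (intro AE_I2 tendsto_eventually)
      fix t :: real
      obtain N where N: "\<bar>t\<bar> \<le> real N" using real_arch_simple by blast
      show "\<forall>\<^sub>F n in sequentially. indicator {- real n..real n} t * h t = h t"
        using eventually_ge_at_top[of N]
      proof eventually_elim
        case (elim n)
        then have "\<bar>t\<bar> \<le> real n" using N by linarith
        then show ?case by (auto simp: indicator_def)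
      qed
    qed
    have "(\<integral>t. indicator {- real n..real n} t * h t \<partial>lborel) = - Im (integral {- real n..real n} k)" for n
      using set_borel_integral_eq_integral(2)[OF set_h[of n]] int_h[of n]
      by (simp add: set_lebesgue_integral_def)
    moreover have "(\<lambda>n. - Im (integral {- real n..real n} k)) \<longlonglongrightarrow> - Im (of_real pi * g z / of_real (Im z))"
      unfolding k_def by (intro tendsto_minus tendsto_Im truncated_poisson_integral_tendsto[OF d hol _ z]) (fact bd)
    ultimately show "(\<lambda>n. \<integral>t. indicator {- real n..real n} t * h t \<partial>lborel) \<longlonglongrightarrow> - (pi * Im (g z) / Im z)"
      by (simp add: Im_divide_of_real)
    show "h \<in> borel_measurable lborel" using borel_measurable_continuous_onI[OF ch] by simp
  qed
  then show ?thesis unfolding h_def .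
qed

text \<open>By the open mapping theorem, a nonconstant holomorphic image would contain a disc, but the
real line contains none.\<close>

lemma holomorphic_Im_zero_constant:
  assumes "f holomorphic_on S" "open S" "connected S" "\<And>z. z \<in> S \<Longrightarrow> Im (f z) = 0"
  shows "f constant_on S"
proof (rule ccontr)
  assume nc: "\<not> f constant_on S"
  then have op: "open (f ` S)" using assms by (intro open_mapping_thm[of f S S]) auto
  have ne: "S \<noteq> {}" using nc by (auto simp: constant_on_def)
  then obtain z where z: "z \<in> S" by auto
  obtain e where e: "e > 0" "ball (f z) e \<subseteq> f ` S" using op z by (auto simp: open_contains_ball)
  have "f z + \<i> * of_real (e / 2) \<in> ball (f z) e" using e by (simp add: dist_norm norm_mult)
  then obtain w where "w \<in> S" "f z + \<i> * of_real (e / 2) = f w" using e by blast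
  then have "Im (f z + \<i> * of_real (e / 2)) = 0" using assms(4) by simp
  then show False using assms(4)[OF z] e by simp
qed

section \<open>Functions that are Cauchy transforms\<close>

text \<open>Stieltjes inversion, for a function that extends holomorphically across the real line: the
measure has density \<open>- Im g / \<pi>\<close>. The Poisson formula on the imaginary axis shows that
its mass is the limit of \<open>- y * Im (g (\<i> y))\<close>, which is 1. The Poisson formula at a general point shows
that its Cauchy transform has the same imaginary part as \<open>g\<close>; the two then differ by a
constant, and both tend to 0 along the imaginary axis.\<close>

lemma cauchy_representation_smooth:
  assumes d: "d > 0" and hol: "g holomorphic_on {z. Im z > - d}"
    and bd: "\<And>z. Im z \<ge> 0 \<Longrightarrow> cmod (g z) \<le> B"
    and neg: "\<And>z. Im z \<ge> 0 \<Longrightarrow> Im (g z) \<le> 0"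
    and decay: "\<And>z. Im z > 0 \<Longrightarrow> cmod (g z) \<le> 1 / Im z"
    and lim: "((\<lambda>y. y * Im (g (\<i> * of_real y))) \<longlongrightarrow> -1) at_top"
  shows "\<exists>M. real_distribution M \<and> (\<forall>z. Im z > 0 \<longrightarrow> cauchy_transform M z = g z)"
proof -
  define u where "u = (\<lambda>t. - Im (g (complex_of_real t)) / pi)"
  have cu: "continuous_on UNIV u"
    unfolding u_def using d
    by (intro continuous_intros continuous_on_compose2[OF holomorphic_on_imp_continuous_on[OF hol]]) auto
  have mu [measurable]: "u \<in> borel_measurable borel" by (rule borel_measurable_continuous_onI[OF cu])
  have u0: "u t \<ge> 0" for t using neg[of "of_real t"] by (simp add: u_def divide_nonpos_pos)
  have pois: "has_bochner_integral lborel (\<lambda>t. u t * (cmod (1 / (z - of_real t)))\<^sup>2) (- Im (g z) / Im z)"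
    if "Im z > 0" for z
  proof -
    have "has_bochner_integral lborel
        (\<lambda>t. - Im (g (of_real t)) * (cmod (1 / (z - of_real t)))\<^sup>2) (- (pi * Im (g z) / Im z))"
      by (rule poisson_integral_formula[OF d hol _ _ that]) (fact bd neg)+
    from has_bochner_integral_mult_right[OF this, where c = "1 / pi"]
    show ?thesis by (simp add: u_def del: norm_divide)
  qed
  \<comment> \<open>At \<open>\<i> y\<close> the Poisson integral, multiplied by \<open>y\<^sup>2\<close>, has the integrand \<open>u t * y\<^sup>2 / (t\<^sup>2 + y\<^sup>2)\<close>, which increases
    to \<open>u t\<close>.\<close>
  have int_u: "has_bochner_integral lborel u 1"
  proof (rule has_bochner_integral_monotone_convergence[where
        f = "\<lambda>n t. u t * ((real (Suc n))\<^sup>2 * (cmod (1 / (\<i> * of_real (real (Suc n)) - of_real t)))\<^sup>2)"])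
    have eq: "(real (Suc n))\<^sup>2 * (cmod (1 / (\<i> * of_real (real (Suc n)) - of_real t)))\<^sup>2
        = (real (Suc n))\<^sup>2 / (t\<^sup>2 + (real (Suc n))\<^sup>2)" for n t
      by (simp add: norm_divide power_divide cmod_power2 del: of_nat_Suc)
    have hb: "has_bochner_integral lborel
        (\<lambda>t. u t * ((real (Suc n))\<^sup>2 * (cmod (1 / (\<i> * of_real (real (Suc n)) - of_real t)))\<^sup>2))
        (- (real (Suc n) * Im (g (\<i> * of_real (real (Suc n))))))" for n
    proof -
      define y where "y = real (Suc n)"
      have y: "Im (\<i> * complex_of_real y) > 0" by (simp add: y_def)
      have "y\<^sup>2 * (- Im (g (\<i> * of_real y)) / Im (\<i> * complex_of_real y)) = - (y * Im (g (\<i> * of_real y)))"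
        using y by (simp add: power2_eq_square)
      with has_bochner_integral_mult_right[OF pois[OF y], where c = "y\<^sup>2"]
      show ?thesis unfolding y_def[symmetric] by (simp only: mult.left_commute)
    qed
    show "integrable lborel (\<lambda>t. u t * ((real (Suc n))\<^sup>2 * (cmod (1 / (\<i> * of_real (real (Suc n)) - of_real t)))\<^sup>2))" for n
      using hb[of n] by (simp add: has_bochner_integral_iff) 
    show "(\<lambda>n. \<integral>t. u t * ((real (Suc n))\<^sup>2 * (cmod (1 / (\<i> * of_real (real (Suc n)) - of_real t)))\<^sup>2) \<partial>lborel) \<longlonglongrightarrow> 1"
    proof -
      have "(\<lambda>n. real (Suc n) * Im (g (\<i> * of_real (real (Suc n))))) \<longlonglongrightarrow> -1"
        by (rule filterlim_compose[OF lim]) (intro filterlim_compose[OF filterlim_real_sequentially filterlim_Suc])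
      from tendsto_minus[OF this] show ?thesis
        by (simp only: has_bochner_integral_integral_eq[OF hb]) simp
    qed
    have mono: "(real (Suc m))\<^sup>2 / (t\<^sup>2 + (real (Suc m))\<^sup>2) \<le> (real (Suc n))\<^sup>2 / (t\<^sup>2 + (real (Suc n))\<^sup>2)"
      if "m \<le> n" for m n t
    proof -
      define a b where "a = (real (Suc m))\<^sup>2" and "b = (real (Suc n))\<^sup>2"
      have "0 < a" "a \<le> b" using that by (auto simp: a_def b_def intro!: power_mono)
      moreover have "t\<^sup>2 * a \<le> t\<^sup>2 * b" using \<open>a \<le> b\<close> by (intro mult_left_mono) auto
      moreover have "t\<^sup>2 + a > 0" "t\<^sup>2 + b > 0"
        using \<open>0 < a\<close> \<open>a \<le> b\<close> by (auto intro!: add_nonneg_pos)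
      ultimately have "a / (t\<^sup>2 + a) \<le> b / (t\<^sup>2 + b)"
        by (simp add: frac_le_eq divide_le_0_iff algebra_simps)
      then show ?thesis by (simp only: a_def b_def)
    qed
    show "AE t in lborel. mono (\<lambda>n. u t * ((real (Suc n))\<^sup>2 * (cmod (1 / (\<i> * of_real (real (Suc n)) - of_real t)))\<^sup>2))"
      unfolding eq using mono u0 by (intro AE_I2 monoI mult_left_mono) 
    show "AE t in lborel. (\<lambda>n. u t * ((real (Suc n))\<^sup>2 * (cmod (1 / (\<i> * of_real (real (Suc n)) - of_real t)))\<^sup>2)) \<longlonglongrightarrow> u t"
    proof (intro AE_I2)
      fix t :: real
      have "(\<lambda>n. u t * ((real (Suc n))\<^sup>2 / (t\<^sup>2 + (real (Suc n))\<^sup>2))) \<longlonglongrightarrow> u t * 1"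
        by (intro tendsto_mult tendsto_const) real_asymp
      then show "(\<lambda>n. u t * ((real (Suc n))\<^sup>2 * (cmod (1 / (\<i> * of_real (real (Suc n)) - of_real t)))\<^sup>2)) \<longlonglongrightarrow> u t"
        unfolding eq by simp
    qed
  qed auto
  define M where "M = density lborel (\<lambda>t. ennreal (u t))"
  have M: "real_distribution M"
  proof -
    have "emeasure M (space M) = ennreal (integral\<^sup>L lborel u)"
      using int_u u0 by (simp add: M_def emeasure_density nn_integral_eq_integral has_bochner_integral_iff)
    then have "prob_space M" using int_u by (intro prob_spaceI) (simp add: has_bochner_integral_iff)
    then show ?thesis by (auto simp: real_distribution_def real_distribution_axioms_def M_def)
  qed
  interpret real_distribution M by (rule M)
  have Im_eq: "Im (cauchy_transform M z) = Im (g z)" if z: "Im z > 0" for z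
  proof -
    have "expectation (\<lambda>x. (cmod (1 / (z - complex_of_real x)))\<^sup>2)
        = (\<integral>t. u t * (cmod (1 / (z - complex_of_real t)))\<^sup>2 \<partial>lborel)"
      unfolding M_def using u0 by (subst integral_density) auto
    also have "\<dots> = - Im (g z) / Im z" using pois[OF z] by (rule has_bochner_integral_integral_eq)
    finally show ?thesis using z by (simp only: Im_cauchy_transform[OF z]) simp
  qed
  have "(\<lambda>z. cauchy_transform M z - g z) constant_on upper_half_plane"
    using Im_eq d
    by (intro holomorphic_Im_zero_constant holomorphic_on_diff cauchy_transform_holomorphic
        holomorphic_on_subset[OF hol] open_upper_half_plane convex_connected convex_upper_half_plane)
      (auto simp: upper_half_plane_def)
  then obtain c where c: "\<And>z. Im z > 0 \<Longrightarrow> cauchy_transform M z - g z = c"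
    by (auto simp: constant_on_def upper_half_plane_def)
  have "c = 0"
  proof (rule ccontr)
    assume "c \<noteq> 0"
    \<comment> \<open>Both functions have modulus at most \<open>1 / y\<close> at \<open>\<i> y\<close>, so any \<open>y\<close> above \<open>2 / cmod c\<close> gives a contradiction.\<close>
    define y where "y = 4 / cmod c"
    have y: "y > 0" using \<open>c \<noteq> 0\<close> by (simp add: y_def)
    have "cmod c \<le> 1 / y + 1 / y"
      using c[of "\<i> * of_real y"] y cauchy_transform_bound[of "\<i> * of_real y"] decay[of "\<i> * of_real y"]
        norm_triangle_ineq4[of "cauchy_transform M (\<i> * of_real y)" "g (\<i> * of_real y)"] by simp
    then show False using \<open>c \<noteq> 0\<close> by (simp add: y_def)
  qed
  then show ?thesis using M c by auto
qed

text \<open>Shifting \<open>G\<close> upwards by \<open>\<epsilon>\<close> makes it holomorphic across the real line, so each shift is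
the Cauchy transform of some probability measure. The limit hypothesis on \<open>G\<close> bounds the tails of
these measures uniformly, and Helly's selection theorem gives a weak limit along some sequence
\<open>\<epsilon> \<rightarrow> 0\<close>. Since the Cauchy kernel is bounded and continuous on the real line, the transforms converge
to that of the limit measure; by continuity of \<open>G\<close> they also converge to \<open>G\<close>.\<close>

lemma cauchy_transform_representation:
  assumes hol: "G holomorphic_on upper_half_plane"
    and bd: "\<And>z. Im z > 0 \<Longrightarrow> cmod (G z) \<le> 1 / Im z"
    and neg: "\<And>z. Im z > 0 \<Longrightarrow> Im (G z) \<le> 0"
    and lim: "((\<lambda>y. y * Im (G (\<i> * of_real y))) \<longlongrightarrow> -1) at_top"
  obtains M where "real_distribution M" "\<And>z. Im z > 0 \<Longrightarrow> cauchy_transform M z = G z"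
proof -
  define e where "e = (\<lambda>n. 1 / real (Suc n))"
  have e: "e n > 0" "e n \<le> 1" for n by (auto simp: e_def)
  have "\<exists>M. real_distribution M \<and> (\<forall>z. Im z > 0 \<longrightarrow> cauchy_transform M z = G (z + \<i> * of_real (e n)))" for n
  proof (rule cauchy_representation_smooth[of "e n" "\<lambda>z. G (z + \<i> * of_real (e n))" "1 / e n"])
    show "(\<lambda>z. G (z + \<i> * of_real (e n))) holomorphic_on {z. Im z > - e n}"
      by (rule holomorphic_on_compose_gen[OF _ hol, unfolded comp_def])
        (auto intro!: holomorphic_intros simp: upper_half_plane_def)
    show "cmod (G (z + \<i> * of_real (e n))) \<le> 1 / e n" if "Im z \<ge> 0" for z
    proof -
      have "cmod (G (z + \<i> * of_real (e n))) \<le> 1 / Im (z + \<i> * of_real (e n))"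
        using that e[of n] by (intro bd) auto
      also have "\<dots> \<le> 1 / e n" using that e[of n] by (intro frac_le) auto
      finally show ?thesis .
    qed
    show "cmod (G (z + \<i> * of_real (e n))) \<le> 1 / Im z" if "Im z > 0" for z
    proof -
      have "cmod (G (z + \<i> * of_real (e n))) \<le> 1 / Im (z + \<i> * of_real (e n))"
        using that e[of n] by (intro bd) auto
      also have "\<dots> \<le> 1 / Im z" using that e[of n] by (intro frac_le) auto
      finally show ?thesis .
    qed
    show "Im (G (z + \<i> * of_real (e n))) \<le> 0" if "Im z \<ge> 0" for z
      using that e[of n] by (intro neg) auto
    have "((\<lambda>y. (y + e n) * Im (G (\<i> * of_real (y + e n)))) \<longlongrightarrow> -1) at_top"
      by (rule filterlim_compose[OF lim]) real_asymp
    moreover have "((\<lambda>y. y / (y + e n)) \<longlongrightarrow> 1) at_top" by real_asymp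
    ultimately have "((\<lambda>y. y / (y + e n) * ((y + e n) * Im (G (\<i> * of_real (y + e n))))) \<longlongrightarrow> 1 * -1) at_top"
      by (intro tendsto_mult)
    moreover have "\<forall>\<^sub>F y in at_top. y / (y + e n) * ((y + e n) * Im (G (\<i> * of_real (y + e n))))
         = y * Im (G (\<i> * of_real y + \<i> * of_real (e n)))"
      using eventually_gt_at_top[of 0] by eventually_elim (use e[of n] in \<open>simp add: distrib_left add_pos_pos\<close>)
    ultimately show "((\<lambda>y. y * Im (G (\<i> * of_real y + \<i> * of_real (e n)))) \<longlongrightarrow> -1) at_top"
      by (simp add: Lim_transform_eventually)
  qed (use e in auto)
  then obtain \<mu> where \<mu>: "\<And>n. real_distribution (\<mu> n)"
    and \<mu>G: "\<And>n z. Im z > 0 \<Longrightarrow> cauchy_transform (\<mu> n) z = G (z + \<i> * of_real (e n))"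
    by metis
  \<comment> \<open>With \<open>s = y + e n\<close>, the tail bound involves \<open>y * Im (G (\<i> s))\<close>. This differs from \<open>s * Im (G (\<i> s))\<close>,
    which is below \<open>- 1 + r\<close>, by at most \<open>e n / s \<le> 1 / y \<le> r\<close>. The interval therefore has mass above
    \<open>1 - 4 r\<close>, whence the choice \<open>r = \<epsilon> / 8\<close>.\<close>
  have "tight \<mu>"
    unfolding tight_def
  proof (intro conjI allI impI \<mu>)
    fix \<epsilon> :: real assume \<epsilon>: "\<epsilon> > 0"
    define r where "r = \<epsilon> / 8"
    have r: "r > 0" using \<epsilon> by (simp add: r_def)
    have "\<forall>\<^sub>F s in at_top. s * Im (G (\<i> * of_real s)) < - 1 + r"
      using r by (intro order_tendstoD(2)[OF lim]) auto
    then obtain Y where Y: "\<And>s. s \<ge> Y \<Longrightarrow> s * Im (G (\<i> * of_real s)) < - 1 + r"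
      by (auto simp: eventually_at_top_linorder)
    define y where "y = max Y (1 / r)"
    have y: "y \<ge> Y" "y \<ge> 1 / r" "y > 0" using r by (auto simp: y_def less_max_iff_disj)
    show "\<exists>a b. a < b \<and> (\<forall>n. measure (\<mu> n) {a<..b} > 1 - \<epsilon>)"
    proof (rule exI[of _ "-y"], rule exI[of _ y], intro conjI allI)
      show "- y < y" using y by simp
      fix n
      interpret real_distribution "\<mu> n" by (rule \<mu>)
      define s where "s = y + e n"
      have s: "s \<ge> Y" "s \<ge> y" "s > 0" using y e[of n] by (auto simp: s_def)
      have eq: "Im (cauchy_transform (\<mu> n) (\<i> * of_real y)) = Im (G (\<i> * of_real s))"
        using \<mu>G[of "\<i> * of_real y" n] y by (simp add: s_def distrib_left)
      have "\<bar>Im (G (\<i> * of_real s))\<bar> \<le> 1 / s"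
        using bd[of "\<i> * of_real s"] s abs_Im_le_cmod[of "G (\<i> * of_real s)"] by simp
      also have "\<dots> \<le> 1 / y" using s y by (intro frac_le) auto
      also have "\<dots> \<le> r" using y r by (simp add: field_simps)
      finally have "e n * \<bar>Im (G (\<i> * of_real s))\<bar> \<le> 1 * r"
        using e[of n] by (intro mult_mono) auto
      moreover have "y * Im (G (\<i> * of_real s)) = s * Im (G (\<i> * of_real s)) - e n * Im (G (\<i> * of_real s))"
        by (simp add: s_def algebra_simps)
      moreover have "\<bar>e n * Im (G (\<i> * of_real s))\<bar> = e n * \<bar>Im (G (\<i> * of_real s))\<bar>"
        using e[of n] by (simp add: abs_mult)
      ultimately have "y * Im (G (\<i> * of_real s)) < - 1 + 2 * r"
        using Y[OF s(1)] by linarith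
      then show "1 - \<epsilon> < prob {-y<..y}"
        using measure_interval_ge_cauchy_transform[OF y(3)] \<epsilon> unfolding eq r_def by linarith
    qed
  qed
  from tight_imp_convergent_subsubsequence[OF this strict_mono_id]
  obtain r M where r: "strict_mono r" and M: "real_distribution M"
    and conv: "weak_conv_m (\<mu> \<circ> r) M" by auto
  show thesis
  proof (rule that[OF M])
    fix z :: complex assume z: "Im z > 0"
    have "(\<lambda>n. cauchy_transform ((\<mu> \<circ> r) n) z) \<longlonglongrightarrow> cauchy_transform M z"
      unfolding cauchy_transform_def
    proof (rule weak_conv_imp_integral_bdd_continuous_conv[OF _ M conv])
      show "real_distribution ((\<mu> \<circ> r) n)" for n using \<mu> by simp
      show "isCont (\<lambda>x. 1 / (z - complex_of_real x)) x" for x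
        using diff_of_real_nonzero[OF z] by (intro continuous_intros) auto
      show "norm (1 / (z - complex_of_real x)) \<le> 1 / Im z" for x by (rule cauchy_kernel_bound[OF z])
    qed
    moreover have "(\<lambda>n. cauchy_transform ((\<mu> \<circ> r) n) z) \<longlonglongrightarrow> G z"
    proof -
      have "e \<longlonglongrightarrow> 0" unfolding e_def by real_asymp
      then have "(\<lambda>n. z + \<i> * of_real (e (r n))) \<longlonglongrightarrow> z + \<i> * of_real 0"
        using LIMSEQ_subseq_LIMSEQ[OF _ r, of e 0] unfolding comp_def by (intro tendsto_intros)
      moreover have "isCont G z"
        using hol z open_upper_half_plane
        by (auto simp: upper_half_plane_def dest!: holomorphic_on_imp_continuous_on
            intro: continuous_on_interior simp: interior_open)
      ultimately have "(\<lambda>n. G (z + \<i> * of_real (e (r n)))) \<longlonglongrightarrow> G z"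
        by (intro isCont_tendsto_compose[of z G]) auto
      then show ?thesis by (simp add: \<mu>G[OF z])
    qed
    ultimately show "cauchy_transform M z = G z" by (rule LIMSEQ_unique)
  qed
qed

section \<open>Composing reciprocal Cauchy transforms\<close>

lemma (in real_distribution) recip_cauchy_transform_holomorphic:
  "recip_cauchy_transform M holomorphic_on upper_half_plane"
  unfolding recip_cauchy_transform_def
  using Im_cauchy_transform_neg
  by (intro holomorphic_intros cauchy_transform_holomorphic) (force simp: upper_half_plane_def)

lemma (in real_distribution) recip_cauchy_transform_nontangential_limit:
  assumes "\<And>n. Im (z n) > 0" "eventually (\<lambda>n. cmod (z n) \<le> C * Im (z n)) sequentially"
    and "filterlim (\<lambda>n. cmod (z n)) at_top sequentially"
  shows "(\<lambda>n. recip_cauchy_transform M (z n) / z n) \<longlonglongrightarrow> 1"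
  using tendsto_inverse[OF cauchy_transform_nontangential_limit[OF assms]]
  by (simp add: recip_cauchy_transform_def field_simps)

theorem theorem6p5:
  fixes \<mu> \<nu> :: "real measure"
  assumes "real_distribution \<mu>" and "real_distribution \<nu>"
  shows "\<exists>\<rho> :: real measure. real_distribution \<rho> \<and>
    (\<forall>z\<in>upper_half_plane.
       recip_cauchy_transform \<mu> (recip_cauchy_transform \<nu> z) - recip_cauchy_transform \<nu> z + z
         = recip_cauchy_transform \<rho> z)"
proof -
  interpret \<mu>: real_distribution \<mu> by fact
  interpret \<nu>: real_distribution \<nu> by fact
  define F1 where "F1 = recip_cauchy_transform \<mu>"
  define F2 where "F2 = recip_cauchy_transform \<nu>"
  define F where "F = (\<lambda>z. F1 (F2 z) - F2 z + z)"
  have F1: "Im (F1 z) \<ge> Im z" if "Im z > 0" for z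
    unfolding F1_def by (rule \<mu>.Im_recip_cauchy_transform_ge[OF that])
  have F2: "Im (F2 z) \<ge> Im z" if "Im z > 0" for z
    unfolding F2_def by (rule \<nu>.Im_recip_cauchy_transform_ge[OF that])
  have F: "Im (F z) \<ge> Im z" if "Im z > 0" for z
    using F1[of "F2 z"] F2[OF that] that by (simp add: F_def)
  have Fnz: "F z \<noteq> 0" if "Im z > 0" for z using F[OF that] that by auto
  have holF: "F holomorphic_on upper_half_plane"
  proof -
    have "F2 holomorphic_on upper_half_plane"
      unfolding F2_def by (rule \<nu>.recip_cauchy_transform_holomorphic)
    moreover from this have "(\<lambda>z. F1 (F2 z)) holomorphic_on upper_half_plane"
      using F2 unfolding F1_def
      by (intro holomorphic_on_compose_gen[OF _ \<mu>.recip_cauchy_transform_holomorphic, unfolded comp_def])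
        (force simp: upper_half_plane_def)+
    ultimately show ?thesis unfolding F_def by (intro holomorphic_intros)
  qed
  \<comment> \<open>With \<open>w = F2 z\<close>, the identity \<open>F z / z = (F1 w / w - 1) * (w / z) + 1\<close> reduces the limit to those of
    \<open>F2 z / z\<close> along the imaginary axis and of \<open>F1 w / w\<close> along its image.\<close>
  have limF: "((\<lambda>y. y * Im (1 / F (\<i> * of_real y))) \<longlongrightarrow> -1) at_top"
  proof (rule tendsto_at_topI_sequentially)
    fix X :: "nat \<Rightarrow> real" assume X: "filterlim X at_top sequentially"
    have "\<forall>\<^sub>F n in sequentially. X n > 0"
      using X by (simp add: filterlim_at_top_dense)
    then obtain N where N: "\<And>n. n \<ge> N \<Longrightarrow> X n > 0" by (auto simp: eventually_sequentially)
    define y where "y = (\<lambda>n. X (n + N))"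
    have y0: "y n > 0" for n unfolding y_def using N by simp
    have y: "filterlim y at_top sequentially"
      unfolding y_def by (rule filterlim_compose[OF X filterlim_add_const_nat_at_top])
    define z where "z = (\<lambda>n. \<i> * complex_of_real (y n))"
    define w where "w = (\<lambda>n. F2 (z n))"
    have z0: "Im (z n) > 0" for n using y0 by (simp add: z_def)
    have znz: "z n \<noteq> 0" for n using z0[of n] by auto
    have cz: "cmod (z n) = y n" for n using y0[of n] by (simp add: z_def norm_mult)
    have "(\<lambda>n. F2 (z n) / z n) \<longlonglongrightarrow> 1"
      unfolding F2_def
      by (rule \<nu>.recip_cauchy_transform_nontangential_limit[where C = 1]) (use z0 y cz in \<open>auto simp: z_def\<close>)
    then have wz: "(\<lambda>n. w n / z n) \<longlonglongrightarrow> 1" by (simp add: w_def)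
    have Imw: "Im (w n) \<ge> y n" for n using F2[OF z0[of n]] by (simp add: w_def z_def)
    have w0: "Im (w n) > 0" for n using Imw[of n] y0[of n] by linarith
    have wnz: "w n \<noteq> 0" for n using w0[of n] by auto
    have "\<forall>\<^sub>F n in sequentially. cmod (w n / z n) < 2"
      using tendsto_norm[OF wz] by (intro order_tendstoD(2)) auto
    \<comment> \<open>The image of the axis stays in a Stolz angle: \<open>cmod (w n)\<close> is eventually below \<open>2 * y n\<close>, and
      \<open>Im (w n)\<close> is at least \<open>y n\<close>.\<close>
    then have nt: "\<forall>\<^sub>F n in sequentially. cmod (w n) \<le> 2 * Im (w n)"
    proof eventually_elim
      case (elim n)
      then have "cmod (w n) < 2 * y n" using y0[of n] by (simp add: norm_divide cz divide_less_eq)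
      then show ?case using Imw[of n] by linarith
    qed
    have "y n \<le> cmod (w n)" for n using Imw[of n] abs_Im_le_cmod[of "w n"] by linarith
    then have cw: "filterlim (\<lambda>n. cmod (w n)) at_top sequentially"
      by (intro filterlim_at_top_mono[OF y]) auto
    have "(\<lambda>n. F1 (w n) / w n) \<longlonglongrightarrow> 1"
      unfolding F1_def by (rule \<mu>.recip_cauchy_transform_nontangential_limit[OF w0 nt cw])
    then have "(\<lambda>n. (F1 (w n) / w n - 1) * (w n / z n) + 1) \<longlonglongrightarrow> (1 - 1) * 1 + 1"
      by (intro tendsto_intros wz)
    moreover have "(F1 (w n) / w n - 1) * (w n / z n) + 1 = F (z n) / z n" for n
      using wnz[of n] znz[of n] unfolding F_def w_def[symmetric] by (simp add: w_def field_simps)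
    ultimately have "(\<lambda>n. F (z n) / z n) \<longlonglongrightarrow> 1" by simp
    then have "(\<lambda>n. Re (inverse (F (z n) / z n))) \<longlonglongrightarrow> Re (inverse 1)"
      by (intro tendsto_intros) auto
    then have lim: "(\<lambda>n. - Re (inverse (F (z n) / z n))) \<longlonglongrightarrow> - 1"
      by (intro tendsto_minus) simp
    have eq: "- Re (inverse (F (z n) / z n)) = y n * Im (1 / F (\<i> * of_real (y n)))" for n
      by (simp add: z_def inverse_eq_divide Re_divide Im_divide)
    show "(\<lambda>n. X n * Im (1 / F (\<i> * of_real (X n)))) \<longlonglongrightarrow> -1"
      by (rule LIMSEQ_offset[where k = N]) (rule lim[unfolded eq, unfolded y_def])
  qed
  obtain \<rho> where \<rho>: "real_distribution \<rho>" "\<And>z. Im z > 0 \<Longrightarrow> cauchy_transform \<rho> z = 1 / F z"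
  proof (rule cauchy_transform_representation[of "\<lambda>z. 1 / F z"])
    show "(\<lambda>z. 1 / F z) holomorphic_on upper_half_plane"
      using Fnz by (intro holomorphic_intros holF) (auto simp: upper_half_plane_def)
    show "cmod (1 / F z) \<le> 1 / Im z" if "Im z > 0" for z
      using F[OF that] that abs_Im_le_cmod[of "F z"] by (simp add: norm_divide frac_le)
    show "Im (1 / F z) \<le> 0" if "Im z > 0" for z
      using F[OF that] that by (simp add: Im_divide divide_nonpos_nonneg)
  qed (use limF in auto)
  show ?thesis
    using \<rho> by (intro exI[of _ \<rho>])
      (auto simp: recip_cauchy_transform_def[of \<rho>] upper_half_plane_def F_def F1_def F2_def)
qed

end
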